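(* Let $m$ be a positive integer with $m>\lceil d_\epsilon\rceil+\lceil\tilde d_{\tilde\epsilon}\rceil$. The (real) tridiagonal matrix $J^{(m)}:=(\Delta^{(m)})^{1/2}L^{(m)}(\Delta^{(m)})^{-1/2}$ is symmetric, with elements $a^{(m)}_1,\ldots,a^{(m)}_m$ on the sub- and superdiagonals (i.e. $J^{(m)}_{l,l+1}=J^{(m)}_{l+1,l}=a^{(m)}_{l+1}$ for $0\leq l<m$) given by $$a^{(m)}_{l+1}:=\begin{cases}a_{l+1}&\text{if }0\leq l<\lceil d_\epsilon\rceil,\\ \bigl(\Delta_l\tilde\Delta_{m-l-1}\bigr)^{-1/2}&\text{if }\lceil d_\epsilon\rceil\leq l<m-\lceil\tilde d_{\tilde\epsilon}\rceil,\\ \tilde a_{m-l}&\text{if }m-\lceil\tilde d_{\tilde\epsilon}\rceil\leq l<m,\end{cases}$$ and elements $b^{(m)}_0,\ldots,b^{(m)}_m$ on the principal diagonal (i.e. $J^{(m)}_{l,l}=b^{(m)}_l$ for $0\leq l\leq m$) of the form $$b^{(m)}_l:=\begin{cases}b_l&\text{if }0\leq l\leq\lceil d_\epsilon\rceil,\\0&\text{if }\lceil d_\epsilon\rceil<l<m-\lceil\tilde d_{\tilde\epsilon}\rceil,\\ \tilde b_{m-l}&\text{if }m-\lceil\tilde d_{\tilde\epsilon}\rceil\leq l\leq m.\end{cases}$$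
   Context: **Parameters.** Fix nonnegative integers $d,\tilde d$, signs $\epsilon_\pm,\tilde\epsilon_\pm\in\{0,1\}$, and parameters $\alpha_1,\ldots,\alpha_d$ and $\tilde\alpha_1,\ldots,\tilde\alpha_{\tilde d}$ with $0<|\alpha_r|<1$, $0<|\tilde\alpha_r|<1$, where possible complex parameters among the $\alpha_r$ occur in complex conjugate pairs, and likewise for the $\tilde\alpha_r$. Put $d_\epsilon:=\frac12(d-\epsilon_+-\epsilon_-)$ and $\tilde d_{\tilde\epsilon}:=\frac12(\tilde d-\tilde\epsilon_+-\tilde\epsilon_-)$. **Bernstein-Szegö polynomials.** Let $$c(\xi):=(1+\epsilon_+e^{-i\xi})^{-1}(1-\epsilon_-e^{-i\xi})^{-1}\prod_{1\leq r\leq d}(1+\alpha_re^{-i\xi}),\qquad w(\xi):=\frac{1}{2\pi|c(\xi)|^2}\quad(0<\xi<\pi).$$ Let $p_l(\xi)$, $l=0,1,2,\ldots$, be the polynomials of degree $l$ in $\cos\xi$ obtained by Gram-Schmidt orthogonalization of $1,\ e^{i\xi}+e^{-i\xi},\ e^{2i\xi}+e^{-2i\xi},\ldots$ in $L^2((0,\pi),w(\xi)d\xi)$, normalized so that their expansion in these functions is unitriangular (leading coefficient 1). Put $\Delta_l:=\int_0^\pi p_l^2(\xi)w(\xi)\,d\xi$ and $\mathtt p_l(\xi):=\Delta_l^{-1}p_l(\xi)$. These satisfy a three-term recurrence $$2\cos(\xi)\mathtt p_l(\xi)=\mathtt p_{l-1}(\xi)+b_l\mathtt p_l(\xi)+a_{l+1}^2\mathtt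 p_{l+1}(\xi),\qquad a_{l+1}:=(\Delta_{l+1}/\Delta_l)^{1/2},\quad \mathtt p_{-1}:=0,$$ which defines the real coefficients $b_l$ ($l\geq0$). The objects $\tilde c(\xi)$, $\tilde\Delta_l$, $\tilde{\mathtt p}_l(\xi)$, $\tilde a_{l+1}$, $\tilde b_l$ are defined in the same way from $\tilde d,\tilde\epsilon_\pm,\tilde\alpha_r$. **The matrices $L^{(m)}$ and $\Delta^{(m)}$.** $L^{(m)}=[L^{(m)}_{l,k}]_{0\leq l,k\leq m}$ is the tridiagonal matrix with $$L^{(m)}_{l,k}:=\begin{cases}\delta_{l-k-1}+b_l\delta_{l-k}+a_{l+1}^2\delta_{l-k+1}&\text{if }0\leq l\leq\lceil d_\epsilon\rceil,\\ \delta_{l-k-1}+\delta_{l-k+1}&\text{if }\lceil d_\epsilon\rceil<l<m-\lceil\tilde d_{\tilde\epsilon}\rceil,\\ \tilde a_{m-l+1}^2\delta_{l-k-1}+\tilde b_{m-l}\delta_{l-k}+\delta_{l-k+1}&\text{if }m-\lceil\tilde d_{\tilde\epsilon}\rceil\leq l\leq m,\end{cases}$$ where $\delta_x:=1$ if $x=0$ and $\delta_x:=0$ otherwise. $\Delta^{(m)}:=\mathrm{diag}(\Delta^{(m)}_0,\ldots,\Delta^{(m)}_m)$ is the positive diagonal matrix with $$\Delta^{(m)}_l:=\begin{cases}\Delta_l&\text{if }0\leq l\leq d_\epsilon,\\1&\text{if }d_\epsilon<l<m-\tilde d_{\tilde\epsilon},\\\tilde\Delta_{m-l}&\text{if }m-\tilde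 d_{\tilde\epsilon}\leq l\leq m.\end{cases}$$ *)

theory Defs
  imports "HOL-Analysis.Analysis" "Jordan_Normal_Form.Matrix"
begin

text \<open>
  One family of parameters: the number \<open>d\<close>, the signs \<open>\<epsilon>\<^sub>+, \<epsilon>\<^sub>-\<close> and \<open>\<alpha>\<^sub>1, \<dots>, \<alpha>\<^sub>d\<close>
  (the values of \<open>bs_alpha\<close> outside \<open>{1..d}\<close> are irrelevant).
\<close>

record bs_param =
  bs_d :: nat
  bs_ep :: nat
  bs_em :: nat
  bs_alpha :: "nat \<Rightarrow> complex"

text \<open>
  The last clause says that non-real parameters occur in complex conjugate pairs, counted with
  multiplicity.
\<close>

definition bs_admissible :: "bs_param \<Rightarrow> bool" where
  "bs_admissible P \<longleftrightarrow>
     bs_ep P \<in> {0, 1} \<and> bs_em P \<in> {0, 1} \<and>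
     (\<forall>r\<in>{1..bs_d P}. 0 < cmod (bs_alpha P r) \<and> cmod (bs_alpha P r) < 1) \<and>
     (\<forall>z. card {r\<in>{1..bs_d P}. bs_alpha P r = cnj z} = card {r\<in>{1..bs_d P}. bs_alpha P r = z})"

text \<open>\<open>d\<^sub>\<epsilon>\<close>; this is a half-integer or an integer, and may be as small as \<open>-1\<close>.\<close>

definition bs_deps :: "bs_param \<Rightarrow> real" where
  "bs_deps P = (real (bs_d P) - real (bs_ep P) - real (bs_em P)) / 2"

definition bs_c :: "bs_param \<Rightarrow> real \<Rightarrow> complex" where
  "bs_c P \<xi> =
     inverse (1 + of_nat (bs_ep P) * exp (- \<i> * of_real \<xi>)) *
     inverse (1 - of_nat (bs_em P) * exp (- \<i> * of_real \<xi>)) *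
     (\<Prod>r\<in>{1..bs_d P}. 1 + bs_alpha P r * exp (- \<i> * of_real \<xi>))"

definition bs_w :: "bs_param \<Rightarrow> real \<Rightarrow> real" where
  "bs_w P \<xi> = 1 / (2 * pi * (cmod (bs_c P \<xi>))\<^sup>2)"

definition bs_inner :: "bs_param \<Rightarrow> (real \<Rightarrow> real) \<Rightarrow> (real \<Rightarrow> real) \<Rightarrow> real" where
  "bs_inner P f g = (LBINT \<xi>:{0<..<pi}. f \<xi> * g \<xi> * bs_w P \<xi>)"

text \<open>The functions \<open>1\<close> and \<open>e\<^sup>i\<^sup>l\<^sup>\<xi> + e\<^sup>-\<^sup>i\<^sup>l\<^sup>\<xi> = 2 cos (l \<xi>)\<close> for \<open>l \<ge> 1\<close>.\<close>

definition bs_mono :: "nat \<Rightarrow> real \<Rightarrow> real" where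
  "bs_mono l \<xi> = (if l = 0 then 1 else 2 * cos (real l * \<xi>))"

text \<open>
  Gram-Schmidt orthogonalization without normalization, so that the coefficient of
  \<open>bs_mono l\<close> in \<open>bs_p P l\<close> is \<open>1\<close>.
\<close>

fun bs_p :: "bs_param \<Rightarrow> nat \<Rightarrow> real \<Rightarrow> real" where
  "bs_p P l = (\<lambda>\<xi>. bs_mono l \<xi> -
     (\<Sum>k\<in>{..<l}. bs_inner P (bs_mono l) (bs_p P k) / bs_inner P (bs_p P k) (bs_p P k) * bs_p P k \<xi>))"

declare bs_p.simps [simp del]

definition bs_Delta :: "bs_param \<Rightarrow> nat \<Rightarrow> real" where
  "bs_Delta P l = (LBINT \<xi>:{0<..<pi}. (bs_p P l \<xi>)\<^sup>2 * bs_w P \<xi>)"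

definition bs_pn :: "bs_param \<Rightarrow> nat \<Rightarrow> real \<Rightarrow> real" where
  "bs_pn P l \<xi> = bs_p P l \<xi> / bs_Delta P l"

text \<open>Meaningful only for indices \<open>l \<ge> 1\<close>.\<close>

definition bs_a :: "bs_param \<Rightarrow> nat \<Rightarrow> real" where
  "bs_a P l = sqrt (bs_Delta P l / bs_Delta P (l - 1))"

definition bs_b :: "bs_param \<Rightarrow> nat \<Rightarrow> real" where
  "bs_b P l = (THE b. \<forall>\<xi>\<in>{0<..<pi}.
     2 * cos \<xi> * bs_pn P l \<xi> =
       (if l = 0 then 0 else bs_pn P (l - 1) \<xi>) + b * bs_pn P l \<xi>
       + (bs_a P (l + 1))\<^sup>2 * bs_pn P (l + 1) \<xi>)"

definition kdelta :: "int \<Rightarrow> real" where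
  "kdelta x = (if x = 0 then 1 else 0)"

text \<open>
  In the following, \<open>P\<close> carries the parameters without tilde and \<open>Q\<close> those with tilde.
  The case distinctions are intended only for \<open>m > \<lceil>bs_deps P\<rceil> + \<lceil>bs_deps Q\<rceil>\<close>, when the
  ranges of \<open>l\<close> in the three cases are disjoint.  Indices are compared in \<open>int\<close> and \<open>real\<close> because
  \<open>d\<^sub>\<epsilon>\<close> can be negative.
\<close>

definition bs_L :: "nat \<Rightarrow> bs_param \<Rightarrow> bs_param \<Rightarrow> real mat" where
  "bs_L m P Q = Matrix.mat (m + 1) (m + 1) (\<lambda>(l, k).
     if int l \<le> \<lceil>bs_deps P\<rceil> then
       kdelta (int l - int k - 1) + bs_b P l * kdelta (int l - int k)
       + (bs_a P (l + 1))\<^sup>2 * kdelta (int l - int k + 1)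
     else if int l < int m - \<lceil>bs_deps Q\<rceil> then
       kdelta (int l - int k - 1) + kdelta (int l - int k + 1)
     else
       (bs_a Q (m - l + 1))\<^sup>2 * kdelta (int l - int k - 1) + bs_b Q (m - l) * kdelta (int l - int k)
       + kdelta (int l - int k + 1))"

definition bs_Delta_mat :: "nat \<Rightarrow> bs_param \<Rightarrow> bs_param \<Rightarrow> real mat" where
  "bs_Delta_mat m P Q = mat_diag (m + 1) (\<lambda>l.
     if real l \<le> bs_deps P then bs_Delta P l
     else if real l < real m - bs_deps Q then 1
     else bs_Delta Q (m - l))"

text \<open>Real powers of a positive diagonal matrix.\<close>

definition diag_powr :: "real mat \<Rightarrow> real \<Rightarrow> real mat" where
  "diag_powr D s = mat_diag (dim_row D) (\<lambda>l. (D $$ (l, l)) powr s)"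

definition bs_J :: "nat \<Rightarrow> bs_param \<Rightarrow> bs_param \<Rightarrow> real mat" where
  "bs_J m P Q =
     diag_powr (bs_Delta_mat m P Q) (1 / 2) * bs_L m P Q * diag_powr (bs_Delta_mat m P Q) (- 1 / 2)"

definition tridiagonal_mat :: "'a :: zero mat \<Rightarrow> bool" where
  "tridiagonal_mat A \<longleftrightarrow>
     (\<forall>i<dim_row A. \<forall>j<dim_col A. i + 1 < j \<or> j + 1 < i \<longrightarrow> A $$ (i, j) = 0)"

end

theory Submission
  imports Defs "HOL-Complex_Analysis.Cauchy_Integral_Formula"
begin

text \<open>
  The essential fact is that \<open>\<Delta>\<^sub>l = 1\<close> for \<open>l > d\<^sub>\<epsilon>\<close>.  Put \<open>q\<^sub>l = 2 Re (c(\<xi>) e\<^sup>i\<^sup>l\<^sup>\<xi>)\<close>.  With \<open>z = e\<^sup>i\<^sup>\<xi>\<close> and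
  \<open>g(z) = (1 + \<epsilon>\<^sub>+ z)(1 - \<epsilon>\<^sub>- z) / \<Prod>\<^sub>r (1 + \<alpha>\<^sub>r z)\<close> one has \<open>q\<^sub>l w = Re (z\<^sup>l g(z)) / \<pi>\<close>, and \<open>g\<close> is holomorphic
  on the disk with real Taylor coefficients, so the mean value property shows that \<open>q\<^sub>l\<close> is
  orthogonal to \<open>cos (k \<xi>)\<close> for \<open>k < l\<close> and has inner product \<open>1\<close> with the monic element of degree
  \<open>l\<close>.  For \<open>l > d\<^sub>\<epsilon>\<close> the function \<open>q\<^sub>l\<close> is itself a monic polynomial of degree \<open>l\<close> in the cosines,
  whence \<open>\<Delta>\<^sub>l = \<langle>p\<^sub>l, p\<^sub>l\<rangle> = \<langle>p\<^sub>l, q\<^sub>l\<rangle> = 1\<close>.  Positivity of \<open>\<Delta>\<^sub>l\<close> for all \<open>l\<close> follows from \<open>\<integral> p\<^sub>l q\<^sub>l w = 1\<close>.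

  Consequently the two boundary blocks of \<open>L\<close> and of the diagonal matrix match the constant
  bulk at the interfaces, and the matrix entries satisfy detailed balance.
\<close>

section \<open>The mean value property\<close>

lemma integral_reflect_0_2pi:
  fixes F :: "real \<Rightarrow> real"
  assumes "continuous_on UNIV F" and refl: "\<And>x. F (2 * pi - x) = F x"
  shows "integral {0..2*pi} F = 2 * integral {0..pi} F"
proof -
  have int: "F integrable_on {a..b}" for a b
    using assms(1) integrable_continuous_interval continuous_on_subset by blast
  have "integral {0..2*pi} F = integral {0..pi} F + integral {pi..2*pi} F"
    by (rule Henstock_Kurzweil_Integration.integral_combine[symmetric]) (auto intro: int)
  moreover have "integral {pi..2*pi} F = integral {0..pi} F"
  proof -
    have "((\<lambda>x. F (-x)) has_integral integral {pi..2*pi} F) {-(2*pi)..-pi}"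
      using int[of pi "2*pi"] by (simp add: integrable_integral)
    from has_integral_affinity[of "\<lambda>x. F (-x)" _ "-(2*pi)" "-pi" 1 "-(2*pi)"] this
    have "((\<lambda>x. F (2*pi - x)) has_integral integral {pi..2*pi} F) ((\<lambda>x. x + 2*pi) ` {-(2*pi)..-pi})"
      by simp
    moreover have "(\<lambda>x. x + 2*pi) ` {-(2*pi)..-pi} = {0..pi}"
      by simp
    ultimately have "(F has_integral integral {pi..2*pi} F) {0..pi}"
      by (simp add: refl)
    then show ?thesis
      by (simp add: integral_unique)
  qed
  ultimately show ?thesis by simp
qed

text \<open>Cauchy's formula at the centre gives the mean over the whole circle. The reality
  condition makes the real part invariant under reflection in the real axis, so the upper half
  circle carries half of it.\<close>

lemma integral_Re_cis_mean_value:
  fixes f :: "complex \<Rightarrow> complex"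
  assumes cont: "continuous_on (cball 0 1) f" and hol: "f holomorphic_on ball 0 1"
    and real: "\<And>z. cmod z = 1 \<Longrightarrow> f (cnj z) = cnj (f z)"
  shows "integral {0..pi} (\<lambda>x. Re (f (cis x))) = pi * Re (f 0)"
proof -
  have "((\<lambda>u. f u / (u - 0)) has_contour_integral (2 * of_real pi * \<i> * f 0)) (circlepath 0 1)"
    by (rule Cauchy_integral_circlepath) (use cont hol in auto)
  then have "((\<lambda>t. f (cis t) * \<i>) has_integral (2 * of_real pi * \<i> * f 0)) {0..2*pi}"
    by (simp add: circlepath_def has_contour_integral_part_circlepath_iff)
  from has_integral_mult_right[OF this, of "-\<i>"]
  have "((\<lambda>t. f (cis t)) has_integral (2 * of_real pi * f 0)) {0..2*pi}"
    by (simp add: algebra_simps)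
  from has_integral_Re[OF this]
  have *: "((\<lambda>t. Re (f (cis t))) has_integral (2 * pi * Re (f 0))) {0..2*pi}"
    by simp
  have "continuous_on UNIV (\<lambda>t. f (cis t))"
    by (rule continuous_on_compose2[OF cont]) (auto intro!: continuous_intros)
  then have c: "continuous_on UNIV (\<lambda>t. Re (f (cis t)))"
    by (intro continuous_intros)
  have "Re (f (cis (2 * pi - x))) = Re (f (cis x))" for x
  proof -
    have "cis (2 * pi - x) = cnj (cis x)"
      by (simp add: complex_eq_iff sin_diff cos_diff)
    then show ?thesis by (simp add: real)
  qed
  from integral_reflect_0_2pi[OF c this] integral_unique[OF *] show ?thesis
    by simp
qed

section \<open>Conjugation symmetry and the analytic function \<open>g\<close>\<close>

lemma prod_cnj_closed:
  fixes a :: "'i \<Rightarrow> complex" and f :: "complex \<Rightarrow> 'b :: comm_monoid_mult"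
  assumes "finite S" and "\<And>z. card {r\<in>S. a r = cnj z} = card {r\<in>S. a r = z}"
  shows "(\<Prod>r\<in>S. f (cnj (a r))) = (\<Prod>r\<in>S. f (a r))"
proof -
  \<comment> \<open>The cardinality condition says that this multiset of values is fixed by
    conjugation, so the product can be transported without choosing an explicit pairing of the
    indices.\<close>
  define M where "M = image_mset a (mset_set S)"
  have cnt: "count M z = card {r\<in>S. a r = z}" for z
  proof -
    have "count M z = (\<Sum>r | r \<in> S \<and> z = a r. 1)"
      unfolding M_def count_image_mset' using assms(1) by (intro sum.cong) auto
    then show ?thesis by (simp add: eq_commute)
  qed
  have cnj: "count (image_mset cnj N) (cnj z) = count N z" for N z
    by (induction N) auto
  have "image_mset cnj M = M"
  proof (rule multiset_eqI)
    fix z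
    have "count (image_mset cnj M) z = count (image_mset cnj M) (cnj (cnj z))"
      by simp
    also have "\<dots> = count M (cnj z)"
      by (rule cnj)
    also have "\<dots> = count M z"
      by (simp add: cnt assms(2))
    finally show "count (image_mset cnj M) z = count M z" .
  qed
  then have "prod_mset (image_mset f (image_mset cnj M)) = prod_mset (image_mset f M)"
    by simp
  then show ?thesis
    by (simp add: M_def multiset.map_comp o_def prod_unfold_prod_mset)
qed

text \<open>For \<open>z = e\<^sup>i\<^sup>\<xi>\<close> this is the inverse of the conjugate of \<open>c(\<xi>)\<close>.\<close>

definition bs_g :: "bs_param \<Rightarrow> complex \<Rightarrow> complex" where
  "bs_g P z = (1 + of_nat (bs_ep P) * z) * (1 - of_nat (bs_em P) * z) /
     (\<Prod>r\<in>{1..bs_d P}. 1 + bs_alpha P r * z)"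

lemma one_plus_mult_neq_0:
  fixes a z :: complex
  assumes "cmod a < 1" "cmod z \<le> 1"
  shows "1 + a * z \<noteq> 0"
proof
  assume "1 + a * z = 0"
  then have "cmod (a * z) = 1"
    by (metis add_eq_0_iff2 norm_minus_cancel norm_one)
  moreover have "cmod (a * z) \<le> cmod a * 1"
    unfolding norm_mult using assms by (intro mult_left_mono) auto
  ultimately show False using assms by simp
qed

locale bernstein_szego =
  fixes P :: bs_param
  assumes adm: "bs_admissible P"
begin

abbreviation "ep \<equiv> bs_ep P"
abbreviation "em \<equiv> bs_em P"
abbreviation "d \<equiv> bs_d P"
abbreviation "\<alpha> \<equiv> bs_alpha P"

lemma ep: "ep = 0 \<or> ep = 1" and em: "em = 0 \<or> em = 1"
  using adm by (auto simp: bs_admissible_def)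

lemma alpha_prod_neq_0: "cmod z \<le> 1 \<Longrightarrow> (\<Prod>r\<in>{1..d}. 1 + \<alpha> r * z) \<noteq> 0"
  using adm one_plus_mult_neq_0 by (auto simp: bs_admissible_def)

lemma alpha_prod_cnj: "cnj (\<Prod>r\<in>{1..d}. 1 + \<alpha> r * z) = (\<Prod>r\<in>{1..d}. 1 + \<alpha> r * cnj z)"
  using prod_cnj_closed[of "{1..d}" \<alpha> "\<lambda>a. 1 + a * cnj z"] adm
  by (simp add: bs_admissible_def)

text \<open>By conjugation symmetry the polynomial equals its average with its conjugate, which
  replaces each coefficient by its real part. In \<open>bs_q_monic\<close> the bound on
  \<open>N\<close> limits how low the indices reach, and \<open>e 0 = 1\<close> gives the leading
  coefficient.\<close>

lemma alpha_prod_expand: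
  obtains e :: "nat \<Rightarrow> real" and N where "N \<le> d" "e 0 = 1"
    "\<And>z. (\<Prod>r\<in>{1..d}. 1 + \<alpha> r * z) = (\<Sum>j\<le>N. of_real (e j) * z ^ j)"
proof -
  define A where "A = (\<Prod>r\<in>{1..d}. [:1, \<alpha> r:])"
  have A: "poly A z = (\<Prod>r\<in>{1..d}. 1 + \<alpha> r * z)" for z
    by (simp add: A_def poly_prod mult.commute)
  have "degree A \<le> (\<Sum>r\<in>{1..d}. degree [:1, \<alpha> r:])"
    unfolding A_def using degree_prod_sum_le[of "{1..d}" "\<lambda>r. [:1, \<alpha> r:]"]
    by (simp add: o_def)
  also have "\<dots> \<le> (\<Sum>r\<in>{1..d}. 1)"
    by (intro sum_mono) auto
  finally have deg: "degree A \<le> d" by simp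
  have "coeff A 0 = 1"
    using A[of 0] by (simp add: poly_0_coeff_0)
  moreover have "poly A z = (\<Sum>j\<le>degree A. of_real (Re (coeff A j)) * z ^ j)" for z
  proof -
    have "poly A z = cnj (poly A (cnj z))"
      unfolding A by (simp only: alpha_prod_cnj complex_cnj_cnj)
    then have "poly A z = (poly A z + cnj (poly A (cnj z))) / 2"
      by simp
    also have "\<dots> = (\<Sum>j\<le>degree A. (coeff A j + cnj (coeff A j)) / 2 * z ^ j)"
      by (simp add: poly_altdef sum.distrib[symmetric] sum_divide_distrib algebra_simps add_divide_distrib)
    also have "\<dots> = (\<Sum>j\<le>degree A. of_real (Re (coeff A j)) * z ^ j)"
      by (simp add: complex_add_cnj)
    finally show ?thesis .
  qed
  ultimately show ?thesis
    using that[of "degree A" "\<lambda>j. Re (coeff A j)"] deg A by simp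
qed

lemma bs_g_cnj: "bs_g P (cnj z) = cnj (bs_g P z)"
  unfolding bs_g_def complex_cnj_divide alpha_prod_cnj by simp

lemma bs_g_continuous: "continuous_on (cball 0 1) (bs_g P)"
  unfolding bs_g_def by (intro continuous_intros) (use alpha_prod_neq_0 in auto)

lemma bs_g_holomorphic: "bs_g P holomorphic_on ball 0 1"
  unfolding bs_g_def by (intro holomorphic_intros) (use alpha_prod_neq_0 in auto)

text \<open>
  Where \<open>g\<close> vanishes, \<open>inverse 0 = 0\<close> makes both sides \<open>0\<close>; hence this identity and the next, and
  continuity of \<open>bs_w\<close>, hold on the whole line.
\<close>

lemma bs_c_eq: "bs_c P \<xi> = inverse (cnj (bs_g P (cis \<xi>)))"
proof -
  have "exp (- \<i> * of_real \<xi>) = cnj (cis \<xi>)"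
    by (simp add: cis_cnj, simp add: cis_conv_exp)
  then show ?thesis
    unfolding bs_c_def bs_g_cnj[symmetric]
    unfolding bs_g_def
    by (simp add: field_simps inverse_mult_distrib)
qed

lemma bs_w_eq: "bs_w P \<xi> = (cmod (bs_g P (cis \<xi>)))\<^sup>2 / (2 * pi)"
  unfolding bs_w_def bs_c_eq by (simp add: norm_divide divide_simps)

lemma continuous_g_cis: "continuous_on S (\<lambda>\<xi>. bs_g P (cis \<xi>))"
  by (rule continuous_on_compose2[OF bs_g_continuous]) (auto intro!: continuous_intros)

lemma continuous_w: "continuous_on S (bs_w P)"
  unfolding bs_w_eq[abs_def] by (intro continuous_intros continuous_g_cis) auto

end

section \<open>Cosine polynomials and orthogonality\<close>

text \<open>Agreement is asked only on the open interval because division by zero can spoil the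
  formulas for \<open>ratio\<close> and \<open>bs_q\<close> at the endpoints. As the index bound is
  strict, membership of \<open>f - bs_mono l\<close> in \<open>cos_span l\<close> says that
  \<open>f\<close> is monic of degree \<open>l\<close>.\<close>

definition cos_span :: "nat \<Rightarrow> (real \<Rightarrow> real) set" where
  "cos_span l = {f. \<exists>r. \<forall>\<xi>\<in>{0<..<pi}. f \<xi> = (\<Sum>k<l. r k * bs_mono k \<xi>)}"

lemma cos_spanI: "(\<And>\<xi>. \<xi> \<in> {0<..<pi} \<Longrightarrow> f \<xi> = (\<Sum>k<l. r k * bs_mono k \<xi>)) \<Longrightarrow> f \<in> cos_span l"
  by (auto simp: cos_span_def)

lemma cos_spanE:
  assumes "f \<in> cos_span l"
  obtains r where "\<And>\<xi>. \<xi> \<in> {0<..<pi} \<Longrightarrow> f \<xi> = (\<Sum>k<l. r k * bs_mono k \<xi>)"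
  using assms by (auto simp: cos_span_def)

lemma cos_span_cong: "f \<in> cos_span l \<Longrightarrow> (\<And>\<xi>. \<xi> \<in> {0<..<pi} \<Longrightarrow> f \<xi> = g \<xi>) \<Longrightarrow> g \<in> cos_span l"
  by (auto simp: cos_span_def)

lemma cos_span_add:
  assumes "f \<in> cos_span l" "g \<in> cos_span l"
  shows "(\<lambda>\<xi>. f \<xi> + g \<xi>) \<in> cos_span l"
proof -
  obtain r where "\<And>\<xi>. \<xi> \<in> {0<..<pi} \<Longrightarrow> f \<xi> = (\<Sum>k<l. r k * bs_mono k \<xi>)"
    using assms(1) by (rule cos_spanE) blast
  moreover obtain s where "\<And>\<xi>. \<xi> \<in> {0<..<pi} \<Longrightarrow> g \<xi> = (\<Sum>k<l. s k * bs_mono k \<xi>)"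
    using assms(2) by (rule cos_spanE) blast
  ultimately show ?thesis
    by (intro cos_spanI[where r = "\<lambda>k. r k + s k"]) (simp add: sum.distrib distrib_right)
qed

lemma cos_span_scale:
  assumes "f \<in> cos_span l"
  shows "(\<lambda>\<xi>. a * f \<xi>) \<in> cos_span l"
proof -
  obtain r where "\<And>\<xi>. \<xi> \<in> {0<..<pi} \<Longrightarrow> f \<xi> = (\<Sum>k<l. r k * bs_mono k \<xi>)"
    using assms by (rule cos_spanE) blast
  then show ?thesis
    by (intro cos_spanI[where r = "\<lambda>k. a * r k"]) (simp add: sum_distrib_left mult.assoc)
qed

lemma cos_span_0: "(\<lambda>\<xi>. 0) \<in> cos_span l"
  by (rule cos_spanI[where r = "\<lambda>k. 0"]) simp

lemma cos_span_sum: "(\<And>i. i \<in> I \<Longrightarrow> f i \<in> cos_span l) \<Longrightarrow> (\<lambda>\<xi>. \<Sum>i\<in>I. f i \<xi>) \<in> cos_span l"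
  by (induction I rule: infinite_finite_induct) (auto intro: cos_span_0 cos_span_add)

lemma cos_span_mono: "l \<le> l' \<Longrightarrow> f \<in> cos_span l \<Longrightarrow> f \<in> cos_span l'"
proof (elim cos_spanE)
  fix r assume "l \<le> l'" and r: "\<And>\<xi>. \<xi> \<in> {0<..<pi} \<Longrightarrow> f \<xi> = (\<Sum>k<l. r k * bs_mono k \<xi>)"
  then show "f \<in> cos_span l'"
    by (intro cos_spanI[where r = "\<lambda>k. if k < l then r k else 0"])
      (auto intro!: sum.mono_neutral_cong_left split: if_splits)
qed

lemma bs_mono_in_cos_span: "k < l \<Longrightarrow> bs_mono k \<in> cos_span l"
  by (rule cos_spanI[where r = "\<lambda>j. if j = k then 1 else 0"]) (simp add: if_distrib[of "\<lambda>x. x * _"] cong: if_cong)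

section \<open>Integrals over the open interval\<close>

lemma set_integrable_Ioo:
  fixes h :: "real \<Rightarrow> real"
  assumes "continuous_on UNIV h"
  shows "set_integrable lborel {a<..<b} h"
proof (rule set_integrable_subset)
  show "set_integrable lborel {a..b} h"
    using assms by (intro borel_integrable_atLeastAtMost' continuous_on_subset[OF assms]) auto
qed auto

lemma set_integral_Ioo:
  fixes h :: "real \<Rightarrow> real"
  assumes "continuous_on UNIV h"
  shows "(LBINT x:{a<..<b}. h x) = integral {a..b} h"
  using set_borel_integral_eq_integral(2)[OF set_integrable_Ioo[OF assms]]
  by (simp add: integral_open_interval_real)

lemma set_integral_Ioo_cong:
  fixes f h :: "real \<Rightarrow> real"
  assumes "\<And>x. x \<in> {a<..<b} \<Longrightarrow> f x = h x"
  shows "(LBINT x:{a<..<b}. f x) = (LBINT x:{a<..<b}. h x)"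
  using assms by (intro set_lebesgue_integral_cong) auto

lemma set_integral_Ioo_sum:
  fixes h :: "'i \<Rightarrow> real \<Rightarrow> real"
  assumes "\<And>i. i \<in> I \<Longrightarrow> continuous_on UNIV (h i)"
  shows "(LBINT x:{a<..<b}. \<Sum>i\<in>I. r i * h i x) = (\<Sum>i\<in>I. r i * (LBINT x:{a<..<b}. h i x))"
  using assms
proof (induction I rule: infinite_finite_induct)
  case (insert i I)
  have "continuous_on UNIV (\<lambda>x. r i * h i x)" "continuous_on UNIV (\<lambda>x. \<Sum>i\<in>I. r i * h i x)"
    using insert.prems by (auto intro!: continuous_intros)
  then show ?case
    using insert by (simp add: set_integral_add set_integrable_Ioo)
qed (simp_all add: set_lebesgue_integral_def)

lemma continuous_bs_mono: "continuous_on S (bs_mono l)"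
  unfolding bs_mono_def[abs_def] by (cases "l = 0") (auto intro!: continuous_intros)

section \<open>The kernel and its pairing with cosines\<close>

context bernstein_szego
begin

text \<open>This is \<open>bs_q l\<close> times the weight, in a form that is continuous on the
  whole line even where \<open>bs_q l\<close> is not.\<close>

definition kernel :: "nat \<Rightarrow> real \<Rightarrow> real" where
  "kernel l \<xi> = Re (cis (real l * \<xi>) * bs_g P (cis \<xi>)) / pi"

definition bs_q :: "nat \<Rightarrow> real \<Rightarrow> real" where
  "bs_q l \<xi> = 2 * Re (bs_c P \<xi> * cis (real l * \<xi>))"

lemma continuous_kernel: "continuous_on S (kernel l)"
  unfolding kernel_def by (intro continuous_intros continuous_g_cis) auto

text \<open>\<open>bs_c\<close> is the inverse of \<open>cnj g\<close> and the weight is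
  proportional to \<open>g * cnj g\<close>, so one factor cancels. Where \<open>g\<close> vanishes,
  so does the weight, and both sides are 0.\<close>

lemma bs_q_weight: "bs_q l \<xi> * bs_w P \<xi> = kernel l \<xi>"
proof (cases "bs_g P (cis \<xi>) = 0")
  case True
  then show ?thesis by (simp add: bs_w_eq kernel_def)
next
  case False
  define g where "g = bs_g P (cis \<xi>)"
  have "bs_q l \<xi> * bs_w P \<xi> = Re (of_real ((cmod g)\<^sup>2) * inverse (cnj g) * cis (real l * \<xi>)) / pi"
    unfolding bs_q_def bs_w_eq bs_c_eq g_def[symmetric] mult.assoc times_complex.sel(1)[of "of_real _"]
    by simp
  also have "of_real ((cmod g)\<^sup>2) * inverse (cnj g) = g"
    using False by (simp only: complex_norm_square g_def[symmetric]) (simp add: field_simps)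
  finally show ?thesis
    by (simp add: kernel_def g_def mult.commute)
qed

text \<open>On the circle, multiplying \<open>z ^ l\<close> by \<open>2 * cos (k * \<xi>)\<close>
  gives \<open>z ^ (l + k) + z ^ (l - k)\<close>, still a polynomial as \<open>k \<le> l\<close>.
  The mean value property evaluates it at 0, where \<open>g\<close> is 1 and only the exponent 0
  survives.\<close>

lemma kernel_bs_mono:
  assumes "k \<le> l"
  shows "(LBINT \<xi>:{0<..<pi}. kernel l \<xi> * bs_mono k \<xi>) = (if k = l then 1 else 0)"
proof -
  define f where "f z = bs_g P z * (if k = 0 then z ^ l else z ^ (l + k) + z ^ (l - k))" for z
  have eq: "kernel l \<xi> * bs_mono k \<xi> = Re (f (cis \<xi>)) / pi" for \<xi>
  proof (cases "k = 0")
    case False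
    have "cis (real l * \<xi>) * of_real (bs_mono k \<xi>) = cis \<xi> ^ (l + k) + cis \<xi> ^ (l - k)"
      using False assms by (simp add: bs_mono_def Complex.DeMoivre of_nat_diff complex_eq_iff
          cos_add sin_add cos_diff sin_diff algebra_simps)
    then have "f (cis \<xi>) = of_real (bs_mono k \<xi>) * (cis (real l * \<xi>) * bs_g P (cis \<xi>))"
      using False by (simp add: f_def mult_ac)
    then show ?thesis
      unfolding kernel_def by simp
  qed (simp add: kernel_def f_def bs_mono_def Complex.DeMoivre mult.commute)
  have "(LBINT \<xi>:{0<..<pi}. kernel l \<xi> * bs_mono k \<xi>) = integral {0..pi} (\<lambda>\<xi>. kernel l \<xi> * bs_mono k \<xi>)"
    by (intro set_integral_Ioo continuous_intros continuous_kernel continuous_bs_mono)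
  also have "\<dots> = integral {0..pi} (\<lambda>\<xi>. Re (f (cis \<xi>))) / pi"
    by (simp add: eq)
  also have "integral {0..pi} (\<lambda>\<xi>. Re (f (cis \<xi>))) = pi * Re (f 0)"
  proof (rule integral_Re_cis_mean_value)
    show "continuous_on (cball 0 1) f" unfolding f_def[abs_def]
      by (cases "k = 0") (auto intro!: continuous_intros bs_g_continuous)
    show "f holomorphic_on ball 0 1" unfolding f_def[abs_def]
      by (cases "k = 0") (auto intro!: holomorphic_intros bs_g_holomorphic)
  qed (simp add: f_def bs_g_cnj)
  also have "f 0 = (if k = l then 1 else 0)"
    using assms by (auto simp: f_def bs_g_def power_0_left)
  finally show ?thesis by simp
qed

text \<open>The kernel annihilates all lower cosines, so pairing with it reads off the leading
  coefficient.\<close>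

lemma kernel_monic:
  assumes "(\<lambda>\<xi>. f \<xi> - bs_mono l \<xi>) \<in> cos_span l"
  shows "(LBINT \<xi>:{0<..<pi}. kernel l \<xi> * f \<xi>) = 1"
proof -
  obtain r where r: "\<And>\<xi>. \<xi> \<in> {0<..<pi} \<Longrightarrow> f \<xi> - bs_mono l \<xi> = (\<Sum>k<l. r k * bs_mono k \<xi>)"
    using assms by (rule cos_spanE) blast
  define s where "s k = (if k = l then 1 else r k)" for k
  have s: "f \<xi> = (\<Sum>k\<le>l. s k * bs_mono k \<xi>)" if "\<xi> \<in> {0<..<pi}" for \<xi>
    using r[OF that] by (simp add: s_def lessThan_Suc_atMost[symmetric])
  have "(LBINT \<xi>:{0<..<pi}. kernel l \<xi> * f \<xi>) =
    (LBINT \<xi>:{0<..<pi}. \<Sum>k\<le>l. s k * (kernel l \<xi> * bs_mono k \<xi>))"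
    by (rule set_integral_Ioo_cong) (simp add: s sum_distrib_left mult_ac)
  also have "\<dots> = (\<Sum>k\<le>l. s k * (if k = l then 1 else 0))"
    by (subst set_integral_Ioo_sum)
      (auto intro!: continuous_intros continuous_kernel continuous_bs_mono sum.cong simp: kernel_bs_mono)
  also have "\<dots> = 1"
    by (simp add: s_def if_distrib cong: if_cong)
  finally show ?thesis .
qed

section \<open>Gram-Schmidt polynomials: positivity and orthogonality\<close>

definition gs_coeff :: "nat \<Rightarrow> nat \<Rightarrow> real" where
  "gs_coeff l k = bs_inner P (bs_mono l) (bs_p P k) / bs_inner P (bs_p P k) (bs_p P k)"

lemma bs_p_eq: "bs_p P l = (\<lambda>\<xi>. bs_mono l \<xi> + (\<Sum>k<l. - gs_coeff l k * bs_p P k \<xi>))"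
  by (subst bs_p.simps) (simp add: gs_coeff_def sum_negf)

lemma bs_mono_eq: "bs_mono l = (\<lambda>\<xi>. bs_p P l \<xi> + (\<Sum>k<l. gs_coeff l k * bs_p P k \<xi>))"
  by (subst bs_p_eq) (simp add: sum_negf)

lemma continuous_bs_p: "continuous_on S (bs_p P l)"
proof (induction l rule: less_induct)
  case (less l)
  then show ?case
    by (subst bs_p_eq) (auto intro!: continuous_intros continuous_bs_mono)
qed

lemma bs_p_monic: "(\<lambda>\<xi>. bs_p P l \<xi> - bs_mono l \<xi>) \<in> cos_span l"
proof (induction l rule: less_induct)
  case (less l)
  have "bs_p P k \<in> cos_span l" if "k < l" for k
  proof -
    have "(\<lambda>\<xi>. (bs_p P k \<xi> - bs_mono k \<xi>) + bs_mono k \<xi>) \<in> cos_span l"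
      using that less[of k] by (intro cos_span_add bs_mono_in_cos_span cos_span_mono[of k l]) auto
    then show ?thesis by simp
  qed
  then have "(\<lambda>\<xi>. \<Sum>k<l. - gs_coeff l k * bs_p P k \<xi>) \<in> cos_span l"
    by (intro cos_span_scale cos_span_sum) auto
  then show ?case
    by (subst bs_p_eq) simp
qed

lemma bs_inner_commute: "bs_inner P f g = bs_inner P g f"
  by (simp add: bs_inner_def mult.commute[of "f _"])

lemma bs_Delta_eq_bs_inner: "bs_Delta P l = bs_inner P (bs_p P l) (bs_p P l)"
  by (simp add: bs_Delta_def bs_inner_def power2_eq_square)

lemma bs_inner_cong:
  "(\<And>\<xi>. \<xi> \<in> {0<..<pi} \<Longrightarrow> g \<xi> = h \<xi>) \<Longrightarrow> bs_inner P f g = bs_inner P f h"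
  unfolding bs_inner_def by (intro set_integral_Ioo_cong) simp

lemma bs_inner_sum_right:
  assumes "continuous_on UNIV f" "\<And>k. k \<in> K \<Longrightarrow> continuous_on UNIV (g k)"
  shows "bs_inner P f (\<lambda>\<xi>. \<Sum>k\<in>K. r k * g k \<xi>) = (\<Sum>k\<in>K. r k * bs_inner P f (g k))"
proof -
  have "bs_inner P f (\<lambda>\<xi>. \<Sum>k\<in>K. r k * g k \<xi>) =
    (LBINT \<xi>:{0<..<pi}. \<Sum>k\<in>K. r k * (f \<xi> * g k \<xi> * bs_w P \<xi>))"
    unfolding bs_inner_def
    by (rule set_integral_Ioo_cong) (simp add: sum_distrib_left sum_distrib_right mult_ac)
  also have "\<dots> = (\<Sum>k\<in>K. r k * bs_inner P f (g k))"
    unfolding bs_inner_def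
    by (rule set_integral_Ioo_sum) (intro continuous_intros assms continuous_w)
  finally show ?thesis .
qed

lemma bs_inner_add_right:
  assumes "continuous_on UNIV f" "continuous_on UNIV g" "continuous_on UNIV h"
  shows "bs_inner P f (\<lambda>\<xi>. g \<xi> + h \<xi>) = bs_inner P f g + bs_inner P f h"
  \<comment> \<open>A binary sum is treated as a sum indexed by the booleans.\<close>
  using bs_inner_sum_right[of f "UNIV :: bool set" "\<lambda>b. if b then g else h" "\<lambda>_. 1"] assms
  by (simp add: UNIV_bool add.commute)

lemma bs_g_neq_0:
  assumes "\<xi> \<in> {0<..<pi}"
  shows "bs_g P (cis \<xi>) \<noteq> 0"
proof -
  have "sin \<xi> > 0"
    using assms by (intro sin_gt_zero) auto
  then have "1 + of_nat ep * cis \<xi> \<noteq> 0" "1 - of_nat em * cis \<xi> \<noteq> 0"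
    using ep em by (auto simp: complex_eq_iff)
  then show ?thesis
    using alpha_prod_neq_0[of "cis \<xi>"] by (auto simp: bs_g_def)
qed

text \<open>A vanishing norm would force \<open>bs_p P l\<close> to vanish on the interval, against
  its kernel integral 1. This precedes orthogonality, which needs nonzero denominators in the
  Gram-Schmidt quotients.\<close>

lemma bs_Delta_pos: "bs_Delta P l > 0"
proof -
  let ?f = "\<lambda>\<xi>. (bs_p P l \<xi>)\<^sup>2 * bs_w P \<xi>"
  have cont: "continuous_on S ?f" for S
    by (intro continuous_intros continuous_bs_p continuous_w)
  have Delta: "bs_Delta P l = integral {0..pi} ?f"
    unfolding bs_Delta_def by (rule set_integral_Ioo[OF cont])
  have nonneg: "?f \<xi> \<ge> 0" for \<xi>
    by (simp add: bs_w_eq)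
  have "integral {0..pi} ?f \<noteq> 0"
  proof
    assume "integral {0..pi} ?f = 0"
    then have *: "\<forall>\<xi>\<in>{0..pi}. ?f \<xi> = 0"
      using integral_eq_0_iff[OF cont pi_gt_zero nonneg] by simp
    have "bs_p P l \<xi> = 0" if "\<xi> \<in> {0<..<pi}" for \<xi>
      using * that bs_g_neq_0[OF that] by (auto simp: bs_w_eq)
    then have "(LBINT \<xi>:{0<..<pi}. kernel l \<xi> * bs_p P l \<xi>) = (LBINT \<xi>:{0<..<pi}. 0)"
      by (intro set_integral_Ioo_cong) auto
    then show False
      using kernel_monic[OF bs_p_monic, of l] by (simp add: set_lebesgue_integral_def)
  qed
  moreover have "integral {0..pi} ?f \<ge> 0"
    by (intro integral_nonneg nonneg integrable_continuous_interval cont)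
  ultimately show ?thesis by (simp add: Delta)
qed

text \<open>Induction on the larger index: among the subtracted projections only the one onto
  \<open>bs_p P k\<close> survives, and it cancels the inner product with
  \<open>bs_mono l\<close>.\<close>

lemma bs_p_orthogonal: "k < l \<Longrightarrow> bs_inner P (bs_p P k) (bs_p P l) = 0"
proof (induction l arbitrary: k rule: less_induct)
  case (less l)
  let ?p = "bs_p P" and ?ip = "bs_inner P"
  have orth: "?ip (?p k) (?p j) = (if j = k then ?ip (?p k) (?p k) else 0)" if "j < l" for j
    using less.IH[of k j] less.IH[of j k] that less.prems bs_inner_commute[of "?p j" "?p k"]
    by (cases j k rule: linorder_cases) auto
  have "?ip (?p k) (?p l) = ?ip (?p k) (\<lambda>\<xi>. bs_mono l \<xi> + (\<Sum>j<l. - gs_coeff l j * ?p j \<xi>))"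
    by (subst bs_p_eq[of l]) simp
  also have "\<dots> = ?ip (?p k) (bs_mono l) + (\<Sum>j<l. - gs_coeff l j * ?ip (?p k) (?p j))"
    by (subst bs_inner_add_right, (intro continuous_intros continuous_bs_p continuous_bs_mono)+)
      (simp only: bs_inner_sum_right continuous_bs_p)
  also have "(\<Sum>j<l. - gs_coeff l j * ?ip (?p k) (?p j)) =
      (\<Sum>j<l. if j = k then - gs_coeff l k * ?ip (?p k) (?p k) else 0)"
    by (intro sum.cong refl, subst orth) auto
  also have "\<dots> = - ?ip (?p k) (bs_mono l)"
    using less.prems bs_Delta_pos[of k, unfolded bs_Delta_eq_bs_inner] bs_inner_commute[of "?p k" "bs_mono l"]
    by (simp add: gs_coeff_def)
  finally show ?case by simp
qed

lemma bs_p_orthogonal_bs_mono: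
  assumes "k < l"
  shows "bs_inner P (bs_p P l) (bs_mono k) = 0"
proof -
  let ?p = "bs_p P" and ?ip = "bs_inner P"
  have "?ip (?p l) (bs_mono k) = ?ip (?p l) (\<lambda>\<xi>. ?p k \<xi> + (\<Sum>j<k. gs_coeff k j * ?p j \<xi>))"
    by (subst bs_mono_eq) simp
  also have "\<dots> = ?ip (?p l) (?p k) + (\<Sum>j<k. gs_coeff k j * ?ip (?p l) (?p j))"
    by (subst bs_inner_add_right, (intro continuous_intros continuous_bs_p)+)
      (simp only: bs_inner_sum_right continuous_bs_p)
  also have "\<dots> = 0"
    using assms by (auto intro!: sum.neutral simp: bs_inner_commute[of "?p l"] bs_p_orthogonal)
  finally show ?thesis .
qed

lemma bs_p_orthogonal_cos_span:
  assumes "f \<in> cos_span l"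
  shows "bs_inner P (bs_p P l) f = 0"
proof -
  obtain r where r: "\<And>\<xi>. \<xi> \<in> {0<..<pi} \<Longrightarrow> f \<xi> = (\<Sum>k<l. r k * bs_mono k \<xi>)"
    using assms by (rule cos_spanE) blast
  have "bs_inner P (bs_p P l) f = bs_inner P (bs_p P l) (\<lambda>\<xi>. \<Sum>k<l. r k * bs_mono k \<xi>)"
    by (rule bs_inner_cong) (rule r)
  also have "\<dots> = 0"
    by (simp add: bs_inner_sum_right continuous_bs_p continuous_bs_mono bs_p_orthogonal_bs_mono)
  finally show ?thesis .
qed

end

section \<open>The norms beyond the half-degree\<close>

context bernstein_szego
begin

definition denom :: "real \<Rightarrow> complex" where
  "denom \<xi> = (1 + of_nat ep * cnj (cis \<xi>)) * (1 - of_nat em * cnj (cis \<xi>))"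

text \<open>
  This is \<open>2 cos (n \<xi>)\<close>, \<open>cos ((n + 1/2) \<xi>) / cos (\<xi>/2)\<close>, \<open>sin ((n + 1/2) \<xi>) / sin (\<xi>/2)\<close> or
  \<open>sin ((n + 1) \<xi>) / sin \<xi>\<close>, depending on the two signs.
\<close>

definition ratio :: "int \<Rightarrow> real \<Rightarrow> real" where
  "ratio n \<xi> = 2 * Re (cis (of_int n * \<xi>) / denom \<xi>)"

lemma denom_neq_0:
  assumes "\<xi> \<in> {0<..<pi}"
  shows "denom \<xi> \<noteq> 0"
proof -
  have "sin \<xi> > 0"
    using assms by (intro sin_gt_zero) auto
  then have "1 + of_nat ep * cnj (cis \<xi>) \<noteq> 0" "1 - of_nat em * cnj (cis \<xi>) \<noteq> 0"
    using ep em by (auto simp: complex_eq_iff)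
  then show ?thesis
    by (simp add: denom_def)
qed

text \<open>Multiplication by \<open>cis \<xi>\<close> turns \<open>1 + cnj (cis \<xi>)\<close> into
  its conjugate and \<open>1 - cnj (cis \<xi>)\<close> into minus its conjugate.\<close>

lemma cnj_denom: "cnj (denom \<xi>) = (-1) ^ em * cis (real (ep + em) * \<xi>) * denom \<xi>"
proof -
  have 1: "cis \<xi> * cnj (cis \<xi>) = 1"
    by (simp add: cis_cnj cis_mult)
  have "cis (real (ep + em) * \<xi>) = cis \<xi> ^ (ep + em)"
    by (simp only: Complex.DeMoivre)
  then show ?thesis
    using ep em 1 by (auto simp: denom_def algebra_simps power2_eq_square)
qed

text \<open>A real part is unchanged by conjugation, and \<open>cnj_denom\<close> restores the
  denominator. The symmetry folds negative indices back to nonnegative ones.\<close>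

lemma ratio_reflect:
  assumes "\<xi> \<in> {0<..<pi}"
  shows "ratio (- n - int (ep + em)) \<xi> = (-1) ^ em * ratio n \<xi>"
proof -
  let ?s = "real (ep + em) * \<xi>" and ?n = "of_int n * \<xi>"
  have "Re (cis (- ?n - ?s) / denom \<xi>) = Re (cnj (cis (- ?n - ?s) / denom \<xi>))"
    by (simp only: cnj.sel)
  also have "cnj (cis (- ?n - ?s) / denom \<xi>) = (cis ?s * cis ?n) / ((-1) ^ em * cis ?s * denom \<xi>)"
    by (simp only: complex_cnj_divide cnj_denom cis_cnj cis_mult minus_diff_eq) (simp add: algebra_simps)
  also have "\<dots> = (-1) ^ em * (cis ?n / denom \<xi>)"
    using em by auto
  also have "Re \<dots> = (-1) ^ em * Re (cis ?n / denom \<xi>)"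
    using em by auto
  finally show ?thesis
    by (simp add: ratio_def algebra_simps)
qed

text \<open>Obtained by expanding the denominator in powers of \<open>e\<^sup>-\<^sup>i\<^sup>\<xi>\<close>.\<close>

lemma ratio_rec:
  assumes "\<xi> \<in> {0<..<pi}"
  shows "ratio n \<xi> + (real ep - real em) * ratio (n - 1) \<xi> - real ep * real em * ratio (n - 2) \<xi>
    = 2 * cos (of_int n * \<xi>)"
proof -
  let ?E = "\<lambda>n. cis (of_int n * \<xi>)"
  have E: "?E (n - 1) = ?E n * cnj (cis \<xi>)" "?E (n - 2) = ?E n * (cnj (cis \<xi>))\<^sup>2" for n
    by (simp_all add: cis_cnj cis_mult power2_eq_square algebra_simps)
  have "ratio n \<xi> + (real ep - real em) * ratio (n - 1) \<xi> - real ep * real em * ratio (n - 2) \<xi> =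
    2 * Re (?E n / denom \<xi> + of_real (real ep - real em) * (?E (n - 1) / denom \<xi>)
      - of_real (real ep * real em) * (?E (n - 2) / denom \<xi>))"
    unfolding ratio_def minus_complex.sel plus_complex.sel times_complex.sel(1)[of "of_real _"] by simp
  also have "?E n / denom \<xi> + of_real (real ep - real em) * (?E (n - 1) / denom \<xi>)
      - of_real (real ep * real em) * (?E (n - 2) / denom \<xi>) = ?E n * denom \<xi> / denom \<xi>"
  proof -
    have "?E n * denom \<xi> = ?E n + of_real (real ep - real em) * ?E (n - 1)
      - of_real (real ep * real em) * ?E (n - 2)"
      unfolding E by (simp add: denom_def algebra_simps power2_eq_square)
    then show ?thesis
      by (simp only: add_divide_distrib diff_divide_distrib times_divide_eq_right)
  qed
  also have "\<dots> = ?E n"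
    using denom_neq_0[OF assms] by simp
  finally show ?thesis by simp
qed

text \<open>By \<open>ratio_rec\<close>, \<open>ratio n\<close> is
  \<open>2 * cos (n * \<xi>)\<close> plus multiples of lower ratios. The case \<open>n = 0\<close>
  without signs is excluded because there \<open>ratio 0\<close> is 2 while \<open>bs_mono 0\<close>
  is 1.\<close>

lemma ratio_monic:
  assumes "n > 0 \<or> ep + em > 0"
  shows "(\<lambda>\<xi>. ratio (int n) \<xi> - bs_mono n \<xi>) \<in> cos_span n"
  using assms
proof (induction n rule: less_induct)
  case (less n)
  show ?case
  proof (cases "n = 0")
    case True
    \<comment> \<open>At least one sign is 1 here. The recurrence at 0 involves one negative index,
      which reflection identifies with \<open>ratio 0\<close> up to sign, leaving
      \<open>2 * ratio 0 \<xi> = 2\<close>.\<close>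
    have "ratio 0 \<xi> = 1" if "\<xi> \<in> {0<..<pi}" for \<xi>
      using ratio_rec[OF that, of 0] ratio_reflect[OF that, of 0] True less.prems ep em
      by auto
    then show ?thesis
      using True by (intro cos_spanI) (simp add: bs_mono_def)
  next
    case False
    have low: "ratio (int k) \<in> cos_span n" if "k < n" "ep + em > 0" for k
    proof -
      have "(\<lambda>\<xi>. (ratio (int k) \<xi> - bs_mono k \<xi>) + bs_mono k \<xi>) \<in> cos_span n"
        using that less.IH[of k] by (intro cos_span_add bs_mono_in_cos_span cos_span_mono[of k n]) auto
      then show ?thesis by simp
    qed
    have 1: "(\<lambda>\<xi>. (real em - real ep) * ratio (int n - 1) \<xi>) \<in> cos_span n"
    proof (cases "ep + em > 0")
      case True
      then show ?thesis
        using low[of "n - 1"] False by (intro cos_span_scale) (simp add: of_nat_diff)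
    qed (simp add: cos_span_0)
    have 2: "(\<lambda>\<xi>. (real ep * real em) * ratio (int n - 2) \<xi>) \<in> cos_span n"
    proof (cases "ep = 1 \<and> em = 1")
      case True
      show ?thesis
      proof (cases "n = 1")
        case True
        \<comment> \<open>With both signs equal to 1, the index -1 is fixed by the reflection, which
          changes the sign of the value.\<close>
        have "ratio (-1) \<xi> = 0" if "\<xi> \<in> {0<..<pi}" for \<xi>
          using ratio_reflect[OF that, of "-1"] \<open>ep = 1 \<and> em = 1\<close> by simp
        then show ?thesis
          using True by (intro cos_span_cong[OF cos_span_0]) simp
      next
        case False
        then show ?thesis
          using low[of "n - 2"] True \<open>n \<noteq> 0\<close> by (intro cos_span_scale) (simp add: of_nat_diff)
      qed
    qed (use ep em in \<open>auto simp: cos_span_0\<close>)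
    show ?thesis
    proof (rule cos_span_cong[OF cos_span_add[OF 1 2]])
      fix \<xi> assume "\<xi> \<in> {0<..<pi}"
      from ratio_rec[OF this, of "int n"] False
      show "(real em - real ep) * ratio (int n - 1) \<xi> + (real ep * real em) * ratio (int n - 2) \<xi>
          = ratio (int n) \<xi> - bs_mono n \<xi>"
        by (simp add: bs_mono_def algebra_simps)
    qed
  qed
qed

text \<open>The bounds put both \<open>n\<close> and its reflection below \<open>l\<close>, and
  whichever is nonnegative is covered by \<open>ratio_monic\<close> or is the constant 2.\<close>

lemma ratio_in_cos_span:
  assumes "n < int l" "- n - int (ep + em) < int l"
  shows "ratio n \<in> cos_span l"
proof -
  have nonneg: "ratio (int k) \<in> cos_span l" if "k < l" for k
  proof (cases "k > 0 \<or> ep + em > 0")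
    case True
    have "(\<lambda>\<xi>. (ratio (int k) \<xi> - bs_mono k \<xi>) + bs_mono k \<xi>) \<in> cos_span l"
      using that ratio_monic[OF True] by (intro cos_span_add bs_mono_in_cos_span cos_span_mono[of k l]) auto
    then show ?thesis by simp
  next
    case False
    then show ?thesis
      using that by (intro cos_span_cong[OF cos_span_scale[OF bs_mono_in_cos_span[of 0], of l 2]])
        (simp_all add: ratio_def denom_def bs_mono_def)
  qed
  \<comment> \<open>If \<open>n\<close> and its reflection are both negative, then \<open>n\<close>
    lies strictly between \<open>-(ep + em)\<close> and 0, which leaves only -1 with both signs
    equal to 1.\<close>
  consider "n \<ge> 0" | "- n - int (ep + em) \<ge> 0" | "n = - 1" "ep = 1" "em = 1"
    using ep em by fastforce
  then show ?thesis
  proof cases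
    case 1
    then show ?thesis
      using nonneg[of "nat n"] assms by simp
  next
    case 2
    then have "ratio (- n - int (ep + em)) \<in> cos_span l"
      using nonneg[of "nat (- n - int (ep + em))"] assms(2) by simp
    from cos_span_scale[OF this, of "(-1) ^ em"] show ?thesis
    proof (rule cos_span_cong)
      fix \<xi> assume "\<xi> \<in> {0<..<pi}"
      from ratio_reflect[OF this, of "n"]
      show "(-1) ^ em * ratio (- n - int (ep + em)) \<xi> = ratio n \<xi>"
        using em by auto
    qed
  next
    case 3
    have "ratio (-1) \<xi> = 0" if "\<xi> \<in> {0<..<pi}" for \<xi>
      using ratio_reflect[OF that, of "-1"] 3 by simp
    then show ?thesis
      using 3 by (intro cos_span_cong[OF cos_span_0]) simp
  qed
qed

text \<open>Expanding the numerator of \<open>bs_c\<close> gives a combination of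
  \<open>ratio (l - j)\<close> with \<open>j \<le> d\<close>. The term \<open>j = 0\<close> is
  monic. The others have lower degree because the reflected index \<open>j - l - (ep + em)\<close>
  stays below \<open>l\<close>, which for \<open>j = d\<close> is exactly the hypothesis.\<close>

lemma bs_q_monic:
  assumes "real l > bs_deps P"
  shows "(\<lambda>\<xi>. bs_q l \<xi> - bs_mono l \<xi>) \<in> cos_span l"
proof -
  have l: "int d < 2 * int l + int (ep + em)"
    using assms by (simp add: bs_deps_def)
  obtain e N where "N \<le> d" "e 0 = 1" and
    e: "\<And>z. (\<Prod>r\<in>{1..d}. 1 + \<alpha> r * z) = (\<Sum>j\<le>N. of_real (e j) * z ^ j)"
    by (rule alpha_prod_expand) (rule that)
  have q: "bs_q l \<xi> = (\<Sum>j\<le>N. e j * ratio (int l - int j) \<xi>)" for \<xi>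
  proof -
    have E: "exp (- \<i> * of_real \<xi>) = cnj (cis \<xi>)"
      by (simp add: cis_cnj, simp add: cis_conv_exp)
    have "bs_c P \<xi> * cis (real l * \<xi>) =
       (\<Sum>j\<le>N. of_real (e j) * cnj (cis \<xi>) ^ j) / denom \<xi> * cis (real l * \<xi>)"
      unfolding bs_c_def E e by (simp add: denom_def field_simps)
    also have "\<dots> = (\<Sum>j\<le>N. of_real (e j) * (cnj (cis \<xi>) ^ j * cis (real l * \<xi>) / denom \<xi>))"
      by (simp add: sum_distrib_left sum_divide_distrib mult_ac)
    also have "\<dots> = (\<Sum>j\<le>N. of_real (e j) * (cis (of_int (int l - int j) * \<xi>) / denom \<xi>))"
      by (simp add: cis_cnj Complex.DeMoivre cis_mult algebra_simps)
    finally have "bs_c P \<xi> * cis (real l * \<xi>) =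
       (\<Sum>j\<le>N. of_real (e j) * (cis (of_int (int l - int j) * \<xi>) / denom \<xi>))" .
    then show ?thesis
      unfolding bs_q_def ratio_def
      by (simp only: Re_sum sum_distrib_left times_complex.sel Re_complex_of_real Im_complex_of_real
          mult_zero_left diff_0_right mult.left_commute)
  qed
  have "(\<lambda>\<xi>. \<Sum>j\<in>{1..N}. e j * ratio (int l - int j) \<xi>) \<in> cos_span l"
    using l \<open>N \<le> d\<close> by (intro cos_span_sum cos_span_scale ratio_in_cos_span) auto
  moreover have "(\<lambda>\<xi>. ratio (int l) \<xi> - bs_mono l \<xi>) \<in> cos_span l"
  proof (rule ratio_monic)
    \<comment> \<open>For \<open>l = 0\<close> the bound reads \<open>d < ep + em\<close>, so some
      sign is 1.\<close>
    show "0 < l \<or> 0 < ep + em" using l by (cases "l = 0") auto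
  qed
  ultimately have "(\<lambda>\<xi>. (ratio (int l) \<xi> - bs_mono l \<xi>) + (\<Sum>j\<in>{1..N}. e j * ratio (int l - int j) \<xi>)) \<in> cos_span l"
    by (rule cos_span_add[rotated])
  moreover have "{..N} = insert 0 {1..N}"
    by auto
  ultimately show ?thesis
    using \<open>e 0 = 1\<close> by (simp add: q algebra_simps)
qed

lemma bs_Delta_eq_1:
  assumes "real l > bs_deps P"
  shows "bs_Delta P l = 1"
proof -
  let ?p = "bs_p P l"
  obtain r where r: "\<And>\<xi>. \<xi> \<in> {0<..<pi} \<Longrightarrow> bs_q l \<xi> - bs_mono l \<xi> = (\<Sum>k<l. r k * bs_mono k \<xi>)"
    using bs_q_monic[OF assms] by (rule cos_spanE) blast
  \<comment> \<open>The cosine polynomial replaces \<open>bs_q l\<close>, which may be discontinuous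
    at the endpoints, because linearity of the inner product is available for continuous
    functions.\<close>
  define q where "q \<xi> = bs_mono l \<xi> + (\<Sum>k<l. r k * bs_mono k \<xi>)" for \<xi>
  have q: "q \<xi> = bs_q l \<xi>" if "\<xi> \<in> {0<..<pi}" for \<xi>
    using r[OF that] by (simp add: q_def)
  have cont: "continuous_on UNIV q"
    unfolding q_def by (intro continuous_intros continuous_bs_mono)
  have "(\<lambda>\<xi>. \<Sum>k<l. (- r k) * bs_mono k \<xi>) \<in> cos_span l"
    by (rule cos_spanI) (rule refl)
  from cos_span_add[OF bs_p_monic this] have "(\<lambda>\<xi>. ?p \<xi> - q \<xi>) \<in> cos_span l"
    by (rule cos_span_cong) (simp add: q_def sum_negf)
  then have 0: "bs_inner P ?p (\<lambda>\<xi>. ?p \<xi> - q \<xi>) = 0"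
    by (rule bs_p_orthogonal_cos_span)
  have "bs_Delta P l = bs_inner P ?p (\<lambda>\<xi>. q \<xi> + (?p \<xi> - q \<xi>))"
    by (simp add: bs_Delta_eq_bs_inner)
  also have "\<dots> = bs_inner P ?p q"
    by (subst bs_inner_add_right) (use 0 in \<open>auto intro!: continuous_intros continuous_bs_p cont\<close>)
  also have "\<dots> = (LBINT \<xi>:{0<..<pi}. kernel l \<xi> * ?p \<xi>)"
    unfolding bs_inner_def
    by (rule set_integral_Ioo_cong) (simp add: q bs_q_weight[symmetric] mult_ac)
  also have "\<dots> = 1"
    by (rule kernel_monic[OF bs_p_monic])
  finally show ?thesis .
qed

end

section \<open>The tridiagonal matrix\<close>

lemma (in bernstein_szego) bs_a_square: "(bs_a P (Suc l))\<^sup>2 = bs_Delta P (Suc l) / bs_Delta P l"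
  using bs_Delta_pos[of l] bs_Delta_pos[of "Suc l"] by (simp add: bs_a_def)

locale bs_pair = p: bernstein_szego P + q: bernstein_szego Q for P Q +
  fixes m :: nat
  assumes m: "int m > \<lceil>bs_deps P\<rceil> + \<lceil>bs_deps Q\<rceil>"
begin

abbreviation "D l \<equiv> bs_Delta_mat m P Q $$ (l, l)"

text \<open>The diagonal matrix is cut at \<open>d_eps\<close> but \<open>bs_L\<close> at its
  ceiling. The two cuts differ only at an index beyond the half-degree, where the norm is 1 anyway,
  so one case distinction serves both.\<close>

lemma D_eq:
  assumes "l \<le> m"
  shows "D l = (if int l \<le> \<lceil>bs_deps P\<rceil> then bs_Delta P l
    else if int l < int m - \<lceil>bs_deps Q\<rceil> then 1 else bs_Delta Q (m - l))"
proof -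
  have "D l = (if real l \<le> bs_deps P then bs_Delta P l
     else if real l < real m - bs_deps Q then 1 else bs_Delta Q (m - l))"
    using assms by (simp add: bs_Delta_mat_def mat_diag_def)
  moreover have "bs_Delta P l = 1" if "\<not> real l \<le> bs_deps P"
    using that by (simp add: p.bs_Delta_eq_1)
  moreover have "bs_Delta Q (m - l) = 1" if "real l < real m - bs_deps Q"
    using that assms by (simp add: q.bs_Delta_eq_1 of_nat_diff)
  moreover have "int l \<le> \<lceil>bs_deps P\<rceil>" if "real l \<le> bs_deps P"
    using that by linarith
  moreover have "real l < real m - bs_deps Q" if "int l < int m - \<lceil>bs_deps Q\<rceil>"
    using that by linarith
  ultimately show ?thesis
    using m by auto
qed

lemma D_pos: "l \<le> m \<Longrightarrow> D l > 0"
  by (simp add: D_eq p.bs_Delta_pos q.bs_Delta_pos)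

lemma bs_J_entry:
  assumes "i \<le> m" "j \<le> m"
  shows "bs_J m P Q $$ (i, j) = sqrt (D i) * bs_L m P Q $$ (i, j) / sqrt (D j)"
proof -
  have dim: "dim_row (bs_Delta_mat m P Q) = m + 1"
    by (simp add: bs_Delta_mat_def mat_diag_def)
  have L: "bs_L m P Q \<in> carrier_mat (m + 1) (m + 1)"
    by (simp add: bs_L_def)
  have "bs_J m P Q = Matrix.mat (m + 1) (m + 1) (\<lambda>(i, j). D i powr (1 / 2) * bs_L m P Q $$ (i, j)) *
      mat_diag (m + 1) (\<lambda>l. D l powr (- 1 / 2))"
    unfolding bs_J_def diag_powr_def dim mat_diag_mult_left[OF L] ..
  also have "\<dots> = Matrix.mat (m + 1) (m + 1) (\<lambda>(i, j). Matrix.mat (m + 1) (m + 1)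
      (\<lambda>(i, j). D i powr (1 / 2) * bs_L m P Q $$ (i, j)) $$ (i, j) * D j powr (- 1 / 2))"
    by (rule mat_diag_mult_right) simp
  finally have "bs_J m P Q $$ (i, j) = D i powr (1 / 2) * bs_L m P Q $$ (i, j) * D j powr (- 1 / 2)"
    using assms by simp
  then show ?thesis
    using D_pos[OF assms(1)] D_pos[OF assms(2)]
    by (simp add: powr_half_sqrt powr_minus_divide)
qed

lemma dim_bs_J: "dim_row (bs_J m P Q) = m + 1" "dim_col (bs_J m P Q) = m + 1"
  by (simp_all add: bs_J_def diag_powr_def bs_Delta_mat_def mat_diag_def)

lemma bs_J_far:
  assumes "i \<le> m" "j \<le> m" "i + 1 < j \<or> j + 1 < i"
  shows "bs_J m P Q $$ (i, j) = 0"
  using assms by (auto simp: bs_J_entry bs_L_def kdelta_def)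

lemma bs_J_diag:
  assumes "l \<le> m"
  shows "bs_J m P Q $$ (l, l) = (if int l \<le> \<lceil>bs_deps P\<rceil> then bs_b P l
         else if int l < int m - \<lceil>bs_deps Q\<rceil> then 0 else bs_b Q (m - l))"
  using D_pos[OF assms] assms by (simp add: bs_J_entry bs_L_def kdelta_def)

lemma bs_L_upper:
  assumes "l < m"
  shows "bs_L m P Q $$ (l, Suc l) =
    (if int l \<le> \<lceil>bs_deps P\<rceil> then bs_Delta P (Suc l) / bs_Delta P l else 1)"
  using assms by (simp add: bs_L_def kdelta_def p.bs_a_square)

text \<open>Left-block and bulk rows both have subdiagonal entry 1, and the bound on
  \<open>m\<close> places every left-block row before the right block.\<close>

lemma bs_L_lower:
  assumes "l < m"
  shows "bs_L m P Q $$ (Suc l, l) =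
    (if int (Suc l) < int m - \<lceil>bs_deps Q\<rceil> then 1 else bs_Delta Q (m - l) / bs_Delta Q (m - l - 1))"
proof -
  have "Suc (m - Suc l) = m - l"
    using assms by simp
  then show ?thesis
    using assms m q.bs_a_square[of "m - Suc l"] by (auto simp: bs_L_def kdelta_def)
qed

text \<open>This identity is equivalent to symmetry of the off-diagonal entries after conjugation by
  the square root of the diagonal matrix.\<close>

lemma detailed_balance:
  assumes "l < m"
  shows "D l * bs_L m P Q $$ (l, Suc l) = D (Suc l) * bs_L m P Q $$ (Suc l, l)"
proof -
  consider "int l < \<lceil>bs_deps P\<rceil>" | "\<lceil>bs_deps P\<rceil> \<le> int l" "int l < int m - \<lceil>bs_deps Q\<rceil>"
    | "int m - \<lceil>bs_deps Q\<rceil> \<le> int l"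
    by linarith
  then show ?thesis
  proof cases
    case 1
    then have "int (Suc l) \<le> \<lceil>bs_deps P\<rceil>" "int (Suc l) < int m - \<lceil>bs_deps Q\<rceil>"
      using m by linarith+
    with 1 show ?thesis
      using assms p.bs_Delta_pos[of l] by (simp add: D_eq bs_L_upper bs_L_lower)
  next
    case 2
    \<comment> \<open>This range contains both interfaces. The norms just past each half-degree are
      1, so the interface entries become reciprocals of the adjacent diagonal entries and both sides
      equal 1.\<close>
    have "bs_Delta P (Suc l) = 1" "bs_Delta Q (m - l) = 1"
      using 2 assms by (auto intro!: p.bs_Delta_eq_1 q.bs_Delta_eq_1 simp: of_nat_diff; linarith)+
    then show ?thesis
      using 2 assms p.bs_Delta_pos[of l] q.bs_Delta_pos[of "m - Suc l"]
      by (simp add: D_eq bs_L_upper bs_L_lower)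
  next
    case 3
    then show ?thesis
      using assms m q.bs_Delta_pos[of "m - Suc l"] by (simp add: D_eq bs_L_upper bs_L_lower)
  qed
qed

lemma bs_J_off_diag:
  assumes "l < m"
  shows "bs_J m P Q $$ (l, Suc l) = bs_J m P Q $$ (Suc l, l)"
proof -
  have pos: "D l > 0" "D (Suc l) > 0"
    using assms by (simp_all add: D_pos)
  define u where "u = sqrt (D l)"
  define v where "v = sqrt (D (Suc l))"
  have uv: "u > 0" "v > 0" "D l = u * u" "D (Suc l) = v * v"
    using pos by (simp_all add: u_def v_def)
  have "u * u * bs_L m P Q $$ (l, Suc l) = v * v * bs_L m P Q $$ (Suc l, l)"
    using detailed_balance[OF assms] by (simp only: uv(3,4))
  then show ?thesis
    using assms uv(1,2) by (simp add: bs_J_entry u_def[symmetric] v_def[symmetric] field_simps)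
qed

lemma bs_J_lower:
  assumes "l < m"
  shows "bs_J m P Q $$ (Suc l, l) =
    (if int l < \<lceil>bs_deps P\<rceil> then bs_a P (Suc l)
     else if int l < int m - \<lceil>bs_deps Q\<rceil>
       then (bs_Delta P l * bs_Delta Q (m - l - 1)) powr (- 1 / 2)
     else bs_a Q (m - l))"
proof -
  have J: "bs_J m P Q $$ (Suc l, l) = sqrt (D (Suc l)) * bs_L m P Q $$ (Suc l, l) / sqrt (D l)"
    using assms by (simp add: bs_J_entry)
  consider "int l < \<lceil>bs_deps P\<rceil>" | "\<lceil>bs_deps P\<rceil> \<le> int l" "int l < int m - \<lceil>bs_deps Q\<rceil>"
    | "int m - \<lceil>bs_deps Q\<rceil> \<le> int l"
    by linarith
  then show ?thesis
  proof cases
    case 1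
    then have "int (Suc l) \<le> \<lceil>bs_deps P\<rceil>" "int (Suc l) < int m - \<lceil>bs_deps Q\<rceil>"
      using m by linarith+
    with 1 show ?thesis
      using assms by (simp add: J D_eq bs_L_lower bs_a_def real_sqrt_divide)
  next
    case 2
    \<comment> \<open>Only at \<open>l = \<lceil>bs_deps P\<rceil>\<close> can this norm differ from
      1. Beyond it the norm and the bulk entry are both 1, so one formula covers the whole range;
      likewise for \<open>DSuc\<close> at the other end.\<close>
    have Dl: "D l = bs_Delta P l"
    proof (cases "int l \<le> \<lceil>bs_deps P\<rceil>")
      case True
      then show ?thesis using assms by (simp add: D_eq)
    next
      case False
      then have "real l > bs_deps P" by linarith
      then show ?thesis using False 2 assms by (simp add: D_eq p.bs_Delta_eq_1)
    qed
    have DSuc: "D (Suc l) = bs_Delta Q (m - Suc l)"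
    proof (cases "int (Suc l) < int m - \<lceil>bs_deps Q\<rceil>")
      case True
      then have "real (m - Suc l) > bs_deps Q" by linarith
      then show ?thesis using True 2 assms by (simp add: D_eq q.bs_Delta_eq_1)
    next
      case False
      then show ?thesis using 2 assms by (simp add: D_eq)
    qed
    have "bs_L m P Q $$ (Suc l, l) = 1 / bs_Delta Q (m - Suc l)"
    proof (cases "int (Suc l) < int m - \<lceil>bs_deps Q\<rceil>")
      case True
      then have "real (m - Suc l) > bs_deps Q" by linarith
      then show ?thesis using True assms by (simp add: bs_L_lower q.bs_Delta_eq_1)
    next
      case False
      have "real (m - l) > bs_deps Q" using 2 by linarith
      then show ?thesis using False assms by (simp add: bs_L_lower q.bs_Delta_eq_1)
    qed
    then have "sqrt (D (Suc l)) * bs_L m P Q $$ (Suc l, l) = 1 / sqrt (bs_Delta Q (m - l - 1))"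
      using q.bs_Delta_pos[of "m - Suc l"] by (simp add: DSuc sqrt_divide_self_eq inverse_eq_divide)
    moreover have "(bs_Delta P l * bs_Delta Q (m - l - 1)) powr (- 1 / 2) =
        1 / (sqrt (bs_Delta P l) * sqrt (bs_Delta Q (m - l - 1)))"
      using p.bs_Delta_pos[of l] q.bs_Delta_pos[of "m - l - 1"]
      by (simp add: powr_minus_divide powr_half_sqrt real_sqrt_mult)
    ultimately show ?thesis
      using 2 by (simp add: J Dl)
  next
    case 3
    define x where "x = sqrt (bs_Delta Q (m - l - 1))"
    have x: "x > 0" "bs_Delta Q (m - l - 1) = x * x"
      using q.bs_Delta_pos[of "m - l - 1"] by (simp_all add: x_def)
    define y where "y = sqrt (bs_Delta Q (m - l))"
    have y: "y > 0" "bs_Delta Q (m - l) = y * y"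
      using q.bs_Delta_pos[of "m - l"] by (simp_all add: y_def)
    have "D l = y * y" "D (Suc l) = x * x" "bs_L m P Q $$ (Suc l, l) = y * y / (x * x)"
      using 3 assms m x y by (simp_all add: D_eq bs_L_lower)
    \<comment> \<open>Conjugation multiplies the subdiagonal entry, the square of
      \<open>y / x\<close>, by \<open>x / y\<close>.\<close>
    then have "bs_J m P Q $$ (Suc l, l) = y / x"
      unfolding J using x(1) y(1) by (simp add: field_simps)
    also have "\<dots> = bs_a Q (m - l)"
      using x(1) y(1) by (simp add: bs_a_def x(2)[simplified] y(2) real_sqrt_divide)
    finally show ?thesis
      using 3 m by simp
  qed
qed

end

theorem proposition3:
  fixes P Q :: bs_param and m :: nat
  assumes "bs_admissible P" and "bs_admissible Q"
    and "m > 0"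
    and "int m > \<lceil>bs_deps P\<rceil> + \<lceil>bs_deps Q\<rceil>"
  shows "tridiagonal_mat (bs_J m P Q) \<and>
    transpose_mat (bs_J m P Q) = bs_J m P Q \<and>
    (\<forall>l<m. bs_J m P Q $$ (l, l + 1) = bs_J m P Q $$ (l + 1, l) \<and>
        bs_J m P Q $$ (l + 1, l) =
        (if int l < \<lceil>bs_deps P\<rceil> then bs_a P (l + 1)
         else if int l < int m - \<lceil>bs_deps Q\<rceil>
           then (bs_Delta P l * bs_Delta Q (m - l - 1)) powr (- 1 / 2)
         else bs_a Q (m - l))) \<and>
    (\<forall>l\<le>m. bs_J m P Q $$ (l, l) =
        (if int l \<le> \<lceil>bs_deps P\<rceil> then bs_b P l
         else if int l < int m - \<lceil>bs_deps Q\<rceil> then 0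
         else bs_b Q (m - l)))"
proof -
  interpret bs_pair P Q m
    using assms by unfold_locales
  have "tridiagonal_mat (bs_J m P Q)"
    by (auto simp: tridiagonal_mat_def dim_bs_J bs_J_far)
  moreover have "transpose_mat (bs_J m P Q) = bs_J m P Q"
  proof (rule eq_matI)
    fix i j assume "i < dim_row (bs_J m P Q)" "j < dim_col (bs_J m P Q)"
    then have ij: "i \<le> m" "j \<le> m"
      by (simp_all add: dim_bs_J)
    consider "i = j" | "j = i + 1" | "i = j + 1" | "i + 1 < j \<or> j + 1 < i"
      by linarith
    then have "bs_J m P Q $$ (j, i) = bs_J m P Q $$ (i, j)"
      by cases (use ij bs_J_off_diag[of i] bs_J_off_diag[of j] in \<open>auto simp: bs_J_far\<close>)
    then show "transpose_mat (bs_J m P Q) $$ (i, j) = bs_J m P Q $$ (i, j)"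
      using ij by (simp add: dim_bs_J)
  qed (simp_all add: dim_bs_J)
  ultimately show ?thesis
    using bs_J_off_diag bs_J_lower bs_J_diag unfolding Suc_eq_plus1 by blast
qed

end
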